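(* Let $X$ be a (nonempty) metric space with metric $d$ and let $T:X\to X$ be a measurable map. Then $$E(T)=\min_{\mu}E_\mu(T),$$ where the minimum is taken over all Borel probability measures $\mu$ of $X$ (in particular, the minimum is attained).
   Context: A map $T:X\to X$ of a metric space is measurable if the preimage under $T$ of every Borel set is a Borel set (the Borel $\sigma$-algebra being the one generated by the open subsets of $X$). A Borel probability measure of $X$ is a $\sigma$-additive measure $\mu$ on the Borel $\sigma$-algebra with $\mu(X)=1$. $B(x,\epsilon)$ denotes the open ball of radius $\epsilon$ centered at $x$. The expansion exponent $E(T)$ of $T$ is the supremum of all $\lambda\in\mathbb{R}$ for which there exists $\epsilon>0$ such that $d(T(x),T(y))\geq e^{\lambda}d(x,y)$ for all $x,y\in X$ with $d(x,y)<\epsilon$. For a Borel probability measure $\mu$, the expansion exponent of $\mu$ with respect to $T$ is $$E_\mu(T)=\sup\{\lambda\in\mathbb{R}\mid \exists\,\epsilon>0 \text{ such that } \mu(\{y\in B(x,\epsilon)\mid d(T(x),T(y))<e^\lambda d(x,y)\})=0 \text{ for all } x\in X\}.$$ In both definitions the convention is $\sup\emptyset=-\infty$, and the suprema take values in $[-\infty,+\infty]$. *)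

theory Defs
  imports "HOL-Probability.Probability"
begin

definition borel_prob_measures :: "'a::metric_space measure set" where
  "borel_prob_measures = {\<mu>. prob_space \<mu> \<and> sets \<mu> = sets borel}"

text \<open>Suprema are taken in \<^typ>\<open>ereal\<close>, where the supremum of the empty set is \<^term>\<open>-\<infinity> :: ereal\<close>.\<close>

definition expansion_exponent :: "('a::metric_space \<Rightarrow> 'a) \<Rightarrow> ereal" where
  "expansion_exponent T =
     Sup (ereal ` {lam::real. \<exists>\<epsilon>>0. \<forall>x y. dist x y < \<epsilon> \<longrightarrow>
                     dist (T x) (T y) \<ge> exp lam * dist x y})"

definition nonexpanding_set :: "('a::metric_space \<Rightarrow> 'a) \<Rightarrow> real \<Rightarrow> real \<Rightarrow> 'a \<Rightarrow> 'a set" where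
  "nonexpanding_set T lam \<epsilon> x = {y \<in> ball x \<epsilon>. dist (T x) (T y) < exp lam * dist x y}"

text \<open>Membership in \<^term>\<open>null_sets \<mu>\<close> below only says that the measure is zero: for a measurable
  map the set is always Borel. Separability is not needed, since the point \<open>x\<close> is fixed.\<close>

lemma nonexpanding_set_borel:
  assumes T: "T \<in> borel \<rightarrow>\<^sub>M borel"
  shows "nonexpanding_set T lam \<epsilon> x \<in> sets borel"
proof -
  have "(\<lambda>z. dist (T x) z) \<in> borel_measurable borel"
    by (intro borel_measurable_continuous_onI continuous_intros)
  from measurable_compose[OF T this]
  have 1: "(\<lambda>y. dist (T x) (T y)) \<in> borel_measurable borel" .
  have 2: "(\<lambda>y. exp lam * dist x y) \<in> borel_measurable borel"
    by (intro borel_measurable_continuous_onI continuous_intros)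
  have "{y \<in> space borel. dist (T x) (T y) < exp lam * dist x y} \<in> sets borel"
    by (rule borel_measurable_less[OF 1 2])
  then have "ball x \<epsilon> \<inter> {y. dist (T x) (T y) < exp lam * dist x y} \<in> sets borel"
    by (intro sets.Int) auto
  then show ?thesis
    by (simp add: nonexpanding_set_def Collect_conj_eq ball_def)
qed

definition measure_expansion_exponent ::
    "'a::metric_space measure \<Rightarrow> ('a \<Rightarrow> 'a) \<Rightarrow> ereal" where
  "measure_expansion_exponent \<mu> T =
     Sup (ereal ` {lam::real. \<exists>\<epsilon>>0. \<forall>x. nonexpanding_set T lam \<epsilon> x \<in> null_sets \<mu>})"

end

theory Submission
  imports Defs
begin

text \<open>The inequality \<open>E(T) \<le> E\<^sub>\<mu>(T)\<close> holds because a rate that is admissible for \<open>T\<close> leaves only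
  empty nonexpanding sets, and these are null for every measure. For attainment, any rate \<open>q\<close> above
  \<open>E(T)\<close> is violated by pairs of points at arbitrarily small distance. Rates may be taken rational
  and scales of the form \<open>1/(m+1)\<close>, so countably many violating pairs witness that no rate above
  \<open>E(T)\<close> is admissible. A purely atomic probability measure which charges the second point of each
  of these pairs then sees every violation (\<open>exists_borel_prob_charging_sequence\<close>), and its
  exponent cannot exceed \<open>E(T)\<close>.\<close>

text \<open>The image of a geometric distribution under the sequence is such a measure: all that
  matters is that every index has positive weight.\<close>

lemma exists_borel_prob_charging_sequence:
  fixes y :: "nat \<Rightarrow> 'a::metric_space"
  obtains \<mu> where "\<mu> \<in> borel_prob_measures" "\<And>n A. y n \<in> A \<Longrightarrow> A \<notin> null_sets \<mu>"
proof
  define p where "p = geometric_pmf (1/2)"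
  define \<mu> where "\<mu> = distr (measure_pmf p) borel y"
  have meas: "y \<in> measurable (measure_pmf p) borel" by simp
  show "\<mu> \<in> borel_prob_measures"
    using measure_pmf.prob_space_distr[OF meas] by (simp add: borel_prob_measures_def \<mu>_def)
  show "A \<notin> null_sets \<mu>" if "y n \<in> A" for n A
  proof
    assume "A \<in> null_sets \<mu>"
    then have "y -` A \<in> null_sets (measure_pmf p)"
      using null_sets_distr_iff[OF meas, of A] by (simp add: \<mu>_def)
    then have "n \<notin> set_pmf p"
      using that by (auto simp: measure_pmf_zero_iff null_sets_def measure_pmf.emeasure_eq_measure)
    then show False by (simp add: p_def set_pmf_geometric)
  qed
qed

lemma nonexpanding_set_mono:
  assumes "lam \<le> lam'" "\<epsilon> \<le> \<epsilon>'"
  shows "nonexpanding_set T lam \<epsilon> x \<subseteq> nonexpanding_set T lam' \<epsilon>' x"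
proof -
  have "exp lam * dist x y \<le> exp lam' * dist x y" for y
    using assms(1) by (intro mult_right_mono) auto
  then show ?thesis
    using assms(2) by (force simp: nonexpanding_set_def intro: less_le_trans)
qed

lemma expansion_exponent_eq_Sup_nonexpanding_empty:
  "expansion_exponent T =
     Sup (ereal ` {lam. \<exists>\<epsilon>>0. \<forall>x. nonexpanding_set T lam \<epsilon> x = {}})"
proof -
  have "nonexpanding_set T lam \<epsilon> x = {} \<longleftrightarrow>
          (\<forall>y. dist x y < \<epsilon> \<longrightarrow> dist (T x) (T y) \<ge> exp lam * dist x y)" for lam \<epsilon> x
    by (force simp: nonexpanding_set_def not_less)
  then show ?thesis
    by (simp add: expansion_exponent_def)
qed

lemma expansion_exponent_le_measure_expansion_exponent:
  "expansion_exponent T \<le> measure_expansion_exponent \<mu> T"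
  unfolding expansion_exponent_eq_Sup_nonexpanding_empty measure_expansion_exponent_def
  by (intro Sup_subset_mono image_mono Collect_mono) (metis null_sets.empty_sets)

lemma nonexpanding_set_nonempty_above_exponent:
  assumes "expansion_exponent T < ereal lam" "\<epsilon> > 0"
  shows "\<exists>x. nonexpanding_set T lam \<epsilon> x \<noteq> {}"
proof (rule ccontr)
  assume "\<not> ?thesis"
  then have "ereal lam \<le> expansion_exponent T"
    unfolding expansion_exponent_eq_Sup_nonexpanding_empty using assms(2)
    by (intro Sup_upper) auto
  with assms(1) show False by simp
qed

lemma exists_measure_expansion_exponent_le:
  fixes T :: "'a::metric_space \<Rightarrow> 'a"
  shows "\<exists>\<mu>\<in>borel_prob_measures. measure_expansion_exponent \<mu> T \<le> expansion_exponent T"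
proof -
  define violates where
    "violates = (\<lambda>(q, m) y. \<exists>x. y \<in> nonexpanding_set T (of_rat q) (1 / real (Suc m)) x)"
  \<comment> \<open>Where no violation exists, \<open>SOME\<close> yields an arbitrary point, and an atom there is harmless.\<close>
  define w :: "rat \<times> nat \<Rightarrow> 'a" where "w = (\<lambda>k. SOME y. violates k y)"
  obtain \<mu> where \<mu>: "\<mu> \<in> borel_prob_measures"
    and charged: "\<And>n A. w (from_nat n) \<in> A \<Longrightarrow> A \<notin> null_sets \<mu>"
    using exists_borel_prob_charging_sequence[of "\<lambda>n. w (from_nat n)"] by blast
  have "ereal lam \<le> expansion_exponent T"
    if "\<epsilon> > 0" and null: "\<And>x. nonexpanding_set T lam \<epsilon> x \<in> null_sets \<mu>" for lam \<epsilon>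
  proof (rule ccontr)
    assume "\<not> ?thesis"
    then obtain q where q: "expansion_exponent T < ereal (of_rat q)" "of_rat q < lam"
      using ereal_dense3[of "expansion_exponent T" "ereal lam"] by (auto simp: not_le)
    obtain m where m: "1 / real (Suc m) < \<epsilon>"
      using nat_approx_posE[OF \<open>\<epsilon> > 0\<close>] by blast
    have "\<exists>y. violates (q, m) y"
      using nonexpanding_set_nonempty_above_exponent[OF q(1), of "1 / real (Suc m)"]
      by (auto simp: violates_def)
    then have "violates (q, m) (w (q, m))"
      unfolding w_def by (rule someI_ex)
    then obtain x where "w (q, m) \<in> nonexpanding_set T (of_rat q) (1 / real (Suc m)) x"
      by (auto simp: violates_def)
    then have "w (q, m) \<in> nonexpanding_set T lam \<epsilon> x"
      using nonexpanding_set_mono[of "of_rat q" lam "1 / real (Suc m)" \<epsilon> T x] q(2) m by auto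
    then show False
      using charged[of "to_nat (q, m)"] null[of x] by simp
  qed
  then have "measure_expansion_exponent \<mu> T \<le> expansion_exponent T"
    unfolding measure_expansion_exponent_def by (intro Sup_least) auto
  with \<mu> show ?thesis by blast
qed

theorem theoremA:
  fixes T :: "'a::metric_space \<Rightarrow> 'a"
  assumes "T \<in> borel \<rightarrow>\<^sub>M borel"
  shows "(\<exists>\<mu>\<in>borel_prob_measures. expansion_exponent T = measure_expansion_exponent \<mu> T) \<and>
         (\<forall>\<mu>\<in>borel_prob_measures. expansion_exponent T \<le> measure_expansion_exponent \<mu> T)"
  using exists_measure_expansion_exponent_le[of T]
  by (auto intro: antisym expansion_exponent_le_measure_expansion_exponent)

end
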